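(* Let $G=(V,E)$ be an infinite graph whose vertex-isoperimetric profile $\partial_V:\mathbb{N}\to\mathbb{N}$ is non-decreasing. Suppose $v_1,v_2,\dots$ is a permutation (enumeration) of the vertices such that, for some $c\in\mathbb{N}$ and all $N\in\mathbb{N}$, $$\Big\{v_j\in V:\ \min_{1\le i\le N} d(v_j,v_i)\le 1\Big\}\subseteq\{v_1,v_2,\dots,v_{N+c\cdot\partial_V(N)}\}.$$ Then for every $f:V\to\mathbb{R}_{\ge 0}$ the associated rearrangement $f^*$ satisfies $$\|\nabla f^*\|_{L^\infty}\le c\cdot\|\nabla f\|_{L^\infty}.$$
   Context: $d$ denotes the graph (shortest-path) distance on $G$. The vertex-isoperimetric profile $\partial_V(k)$, for $k\in\mathbb{N}$, is the largest integer such that every set $A\subseteq V$ with $\#A=k$ is adjacent to at least $\partial_V(k)$ vertices of $V\setminus A$. For $g:V\to\mathbb{R}$, $\|\nabla g\|_{L^\infty}=\sup_{(v,w)\in E}|g(v)-g(w)|$. Given the enumeration $v_1,v_2,\dots$ of $V$, the associated rearrangement of a nonnegative function $f$ is $f^*$ defined by $f^*(v_k)=$ the $k$-th largest value assumed by $f$ (values counted with multiplicity).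
   Formalization: The claim is stated for exactly those nonnegative f whose rearrangement f* exists, i.e. for which a k-th largest assumed value exists for every k; for other f (e.g. unbounded f, or f not attaining its supremum) f* is undefined. *)

theory Defs
  imports
    "HOL-Library.Extended_Nonnegative_Real"
    "Graph_Theory.Graph_Theory"
begin

text \<open>
  A simple undirected, possibly infinite graph is a \<^locale>\<open>pair_bidirected_digraph\<close>:
  a loop-free digraph with a symmetric set of arcs, so that an undirected edge appears as
  two opposite arcs.
\<close>

text \<open>The distance is infinite between vertices in different components.\<close>

definition graph_dist :: "'a pair_pre_digraph \<Rightarrow> 'a \<Rightarrow> 'a \<Rightarrow> ereal" where
  "graph_dist G u w = wf_digraph.\<mu> (with_proj G) (\<lambda>_. 1) u w"

definition vertex_boundary :: "'a pair_pre_digraph \<Rightarrow> 'a set \<Rightarrow> 'a set" where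
  "vertex_boundary G A = {w \<in> pverts G - A. \<exists>u\<in>A. (u, w) \<in> parcs G}"

text \<open>Since \<^const>\<open>card\<close> is 0 on infinite sets, those need a separate case.\<close>

definition has_at_least :: "'a set \<Rightarrow> nat \<Rightarrow> bool" where
  "has_at_least S m \<longleftrightarrow> infinite S \<or> m \<le> card S"

text \<open>
  The greatest number exists as soon as some k-element set of vertices has a finite boundary,
  in particular for every k in an infinite locally finite graph.
\<close>

definition vertex_profile :: "'a pair_pre_digraph \<Rightarrow> nat \<Rightarrow> nat" where
  "vertex_profile G k = (GREATEST m. \<forall>A\<subseteq>pverts G. finite A \<and> card A = k \<longrightarrow>
     has_at_least (vertex_boundary G A) m)"

text \<open>The value is 0 if there are no edges, as suprema are taken in \<^typ>\<open>ennreal\<close>.\<close>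

definition grad_sup_norm :: "'a pair_pre_digraph \<Rightarrow> ('a \<Rightarrow> real) \<Rightarrow> ennreal" where
  "grad_sup_norm G g = (SUP (u, w)\<in>parcs G. ennreal \<bar>g u - g w\<bar>)"

text \<open>
  With multiplicities, \<open>t\<close> is the k-th largest value iff fewer than \<open>k\<close> vertices have a
  value above \<open>t\<close> and at least \<open>k\<close> vertices have a value of \<open>t\<close> or more.
  There is at most one such \<open>t\<close>, and it is a value of \<open>f\<close>. There may be none
  (for instance if \<open>f\<close> is unbounded).
\<close>

definition kth_largest_value :: "'a set \<Rightarrow> ('a \<Rightarrow> real) \<Rightarrow> nat \<Rightarrow> real \<Rightarrow> bool" where
  "kth_largest_value V f k t \<longleftrightarrow>
     \<not> has_at_least {x \<in> V. f x > t} k \<and> has_at_least {x \<in> V. f x \<ge> t} k"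

lemma has_at_least_mono: "has_at_least S m \<Longrightarrow> S \<subseteq> T \<Longrightarrow> has_at_least T m"
  unfolding has_at_least_def by (meson card_mono finite_subset order_trans)

lemma kth_largest_value_unique:
  assumes "kth_largest_value V f k s" "kth_largest_value V f k t"
  shows "s = t"
proof -
  have "\<not> s' < t'" if "kth_largest_value V f k s'" "kth_largest_value V f k t'" for s' t'
    using that has_at_least_mono[of "{x \<in> V. f x \<ge> t'}" k "{x \<in> V. f x > s'}"]
    unfolding kth_largest_value_def by fastforce
  with assms show ?thesis by (meson linorder_neqE)
qed

lemma kth_largest_value_assumed:
  assumes "kth_largest_value V f k t"
  shows "t \<in> f ` V"
proof (rule ccontr)
  assume "t \<notin> f ` V"
  then have "{x \<in> V. f x \<ge> t} = {x \<in> V. f x > t}" by (force simp: order_le_less)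
  with assms show False by (simp add: kth_largest_value_def)
qed

definition is_rearrangement ::
  "'a set \<Rightarrow> (nat \<Rightarrow> 'a) \<Rightarrow> ('a \<Rightarrow> real) \<Rightarrow> ('a \<Rightarrow> real) \<Rightarrow> bool" where
  "is_rearrangement V v f f' \<longleftrightarrow> (\<forall>k\<ge>1. kth_largest_value V f k (f' (v k)))"

end

theory Submission
  imports Defs
begin

text \<open>
  Write \<open>t k\<close> for the value of the rearrangement at \<open>v k\<close>, let \<open>L\<close> bound the gradient of \<open>f\<close>,
  and let \<open>A\<close> consist of \<open>k\<close> vertices where \<open>f\<close> is at least \<open>t k\<close>. On the boundary of \<open>A\<close>, \<open>f\<close> is at
  least \<open>t k - L\<close>, so at least \<open>k + \<partial> k\<close> vertices have such a value, that is,
  \<open>t (k + \<partial> k) \<ge> t k - L\<close>. By monotonicity of \<open>\<partial>\<close>, moving \<open>c\<close> times by \<open>\<partial> i\<close> from \<open>i\<close> costs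
  at most \<open>c L\<close>, and the hypothesis on the enumeration says that all later neighbours of \<open>v i\<close>
  have index at most \<open>i + c \<partial> i\<close>.
\<close>

text \<open>
  If every \<open>k\<close>-element set has an infinite boundary, the profile is an unspecified number, but
  then any number is a valid bound.
\<close>

lemma vertex_boundary_has_at_least:
  assumes "A \<subseteq> pverts G" "finite A" "card A = k"
  shows "has_at_least (vertex_boundary G A) (vertex_profile G k)"
proof -
  define P where "P m \<longleftrightarrow> (\<forall>A\<subseteq>pverts G. finite A \<and> card A = k \<longrightarrow>
    has_at_least (vertex_boundary G A) m)" for m
  have down: "P m" if "P n" "m \<le> n" for m n
    using that unfolding P_def has_at_least_def by (blast intro: order_trans)
  have "P (Greatest P)"
  proof (cases "\<exists>b. \<forall>m. P m \<longrightarrow> m \<le> b")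
    case True
    moreover have "P 0"
      by (simp add: P_def has_at_least_def)
    ultimately show ?thesis
      by (blast intro: GreatestI_nat)
  next
    \<comment> \<open>\<open>P\<close> is unbounded and closed downwards, so it holds at every
      number, including the unspecified \<open>Greatest P\<close>.\<close>
    case False
    then show ?thesis
      using down by (meson nat_le_linear)
  qed
  moreover have "vertex_profile G k = Greatest P"
    by (simp add: vertex_profile_def P_def[abs_def])
  ultimately show ?thesis
    using assms by (simp add: P_def)
qed

lemma has_at_least_obtain_subset:
  assumes "has_at_least S k"
  obtains A where "A \<subseteq> S" "finite A" "card A = k"
  using assms unfolding has_at_least_def
  by (metis infinite_arbitrarily_large obtain_subset_with_card_n)

lemma has_at_least_Un_disjoint:
  assumes "has_at_least S m" "has_at_least T n" "S \<inter> T = {}"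
  shows "has_at_least (S \<union> T) (m + n)"
  using assms by (auto simp: has_at_least_def card_Un_disjoint)

lemma kth_largest_value_antimono:
  assumes "kth_largest_value V f i s" "kth_largest_value V f j t" "i \<le> j"
  shows "t \<le> s"
proof (rule ccontr)
  assume "\<not> t \<le> s"
  then have "{x \<in> V. t \<le> f x} \<subseteq> {x \<in> V. s < f x}"
    by auto
  moreover have "has_at_least {x \<in> V. t \<le> f x} i"
    using assms by (auto simp: kth_largest_value_def has_at_least_def)
  ultimately have "has_at_least {x \<in> V. s < f x} i"
    by (rule has_at_least_mono[rotated])
  with assms show False
    by (simp add: kth_largest_value_def)
qed

lemma kth_largest_value_profile_step:
  assumes lip: "\<And>x y. (x, y) \<in> parcs G \<Longrightarrow> \<bar>f x - f y\<bar> \<le> L"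
    and "0 \<le> L"
    and s: "kth_largest_value (pverts G) f k s"
    and t: "kth_largest_value (pverts G) f (k + vertex_profile G k) t"
  shows "s - L \<le> t"
proof (rule ccontr)
  assume less: "\<not> s - L \<le> t"
  \<comment> \<open>Ties can make this set larger than \<open>k\<close>, even infinite, so
    \<open>k\<close> of its elements are selected.\<close>
  obtain A where A: "A \<subseteq> {x \<in> pverts G. s \<le> f x}" "finite A" "card A = k"
    using s has_at_least_obtain_subset unfolding kth_largest_value_def by blast
  have "has_at_least (A \<union> vertex_boundary G A) (k + vertex_profile G k)"
  proof (rule has_at_least_Un_disjoint)
    show "has_at_least A k"
      using A by (simp add: has_at_least_def)
    show "has_at_least (vertex_boundary G A) (vertex_profile G k)"
      using A by (intro vertex_boundary_has_at_least) auto
    show "A \<inter> vertex_boundary G A = {}"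
      by (auto simp: vertex_boundary_def)
  qed
  \<comment> \<open>As \<open>t < s - L\<close>, one arc out of \<open>A\<close> cannot bring
    \<open>f\<close> down to \<open>t\<close>; too many vertices then lie strictly above
    \<open>t\<close>.\<close>
  moreover have "A \<union> vertex_boundary G A \<subseteq> {x \<in> pverts G. t < f x}"
  proof
    fix w assume "w \<in> A \<union> vertex_boundary G A"
    then consider "w \<in> A" | u where "w \<in> pverts G" "u \<in> A" "(u, w) \<in> parcs G"
      by (auto simp: vertex_boundary_def)
    then show "w \<in> {x \<in> pverts G. t < f x}"
    proof cases
      case 1
      then show ?thesis
        using A less \<open>0 \<le> L\<close> by auto
    next
      case 2
      then have "s \<le> f u" "\<bar>f u - f w\<bar> \<le> L"
        using A lip by auto
      then show ?thesis
        using 2 less by auto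
    qed
  qed
  ultimately have "has_at_least {x \<in> pverts G. t < f x} (k + vertex_profile G k)"
    by (rule has_at_least_mono)
  with t show False
    by (simp add: kth_largest_value_def)
qed

text \<open>All \<open>m\<close> steps have the length \<open>vertex_profile G i\<close> fixed at
  the start. The profile at later positions is no smaller, and stopping a step early can only raise
  the value reached.\<close>

lemma kth_largest_value_profile_steps:
  assumes lip: "\<And>x y. (x, y) \<in> parcs G \<Longrightarrow> \<bar>f x - f y\<bar> \<le> L"
    and "0 \<le> L"
    and mono: "mono (vertex_profile G)"
    and t: "\<And>k. 1 \<le> k \<Longrightarrow> kth_largest_value (pverts G) f k (t k)"
    and "1 \<le> i"
  shows "t i - real m * L \<le> t (i + m * vertex_profile G i)"
proof (induction m)
  case 0
  then show ?case by simp
next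
  case (Suc m)
  define k where "k = i + m * vertex_profile G i"
  have k: "1 \<le> k" "i \<le> k"
    using \<open>1 \<le> i\<close> by (auto simp: k_def)
  have "t k - L \<le> t (k + vertex_profile G k)"
    using kth_largest_value_profile_step[OF lip \<open>0 \<le> L\<close> t t] k by simp
  also have "\<dots> \<le> t (k + vertex_profile G i)"
    using k monoD[OF mono \<open>i \<le> k\<close>]
    by (intro kth_largest_value_antimono[OF t t]) auto
  finally show ?case
    using Suc.IH by (simp add: k_def algebra_simps)
qed

lemma graph_dist_arc_le_1:
  assumes "pair_wf_digraph G" "(x, y) \<in> parcs G"
  shows "graph_dist G x y \<le> 1"
proof -
  interpret pair_wf_digraph G by fact
  have "awalk x [(x, y)] y"
    using arc_implies_awalk[of "(x, y)"] assms(2) by simp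
  then have "\<mu> (\<lambda>_. 1) x y \<le> ereal (awalk_cost (\<lambda>_. 1) [(x, y)])"
    by (rule min_cost_le_walk_cost)
  then show ?thesis
    by (simp add: graph_dist_def one_ereal_def)
qed

lemma grad_sup_norm_le_iff:
  "grad_sup_norm G g \<le> b \<longleftrightarrow> (\<forall>(x, y)\<in>parcs G. ennreal \<bar>g x - g y\<bar> \<le> b)"
  by (auto simp: grad_sup_norm_def SUP_le_iff)

theorem theorem3:
  fixes G :: "'a pair_pre_digraph" and v :: "nat \<Rightarrow> 'a" and c :: nat
    and f f_star :: "'a \<Rightarrow> real"
  assumes "pair_bidirected_digraph G"
    and "infinite (pverts G)"
    and "mono (vertex_profile G)"
    and "bij_betw v {1..} (pverts G)"
    and "\<forall>N\<ge>1. {v j | j. j \<ge> 1 \<and> Min ((\<lambda>i. graph_dist G (v j) (v i)) ` {1..N}) \<le> 1}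
           \<subseteq> v ` {1..N + c * vertex_profile G N}"
    and "\<forall>x\<in>pverts G. 0 \<le> f x"
    and "is_rearrangement (pverts G) v f f_star"
  shows "grad_sup_norm G f_star \<le> of_nat c * grad_sup_norm G f"
proof -
  interpret pair_bidirected_digraph G by fact
  define t where "t k = f_star (v k)" for k
  have t: "kth_largest_value (pverts G) f k (t k)" if "1 \<le> k" for k
    using assms(7) that by (simp add: is_rearrangement_def t_def)
  \<comment> \<open>The hypothesis at \<open>N = i\<close> places \<open>v j\<close> among the
    listed vertices, and injectivity of \<open>v\<close> turns this into a bound on
    \<open>j\<close>.\<close>
  have later: "j \<le> i + c * vertex_profile G i"
    if "1 \<le> i" "1 \<le> j" "(v j, v i) \<in> parcs G" for i j
  proof -
    have "Min ((\<lambda>l. graph_dist G (v j) (v l)) ` {1..i}) \<le> graph_dist G (v j) (v i)"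
      using that by (intro Min_le) auto
    also have "\<dots> \<le> 1"
      using that by (intro graph_dist_arc_le_1) unfold_locales
    finally have "v j \<in> v ` {1..i + c * vertex_profile G i}"
      using assms(5) that by blast
    then show ?thesis
      using that bij_betw_imp_inj_on[OF assms(4)] by (auto dest: inj_onD)
  qed
  have ordered: "ennreal \<bar>t i - t j\<bar> \<le> of_nat c * grad_sup_norm G f"
    if ij: "1 \<le> i" "i < j" "(v j, v i) \<in> parcs G" for i j
  proof (cases "grad_sup_norm G f = top")
    case True
    \<comment> \<open>In \<open>ennreal\<close>, \<open>0 * top = 0\<close>, so an infinite gradient
      settles the claim only for positive \<open>c\<close>. With \<open>c = 0\<close>,
      \<open>later\<close> would give \<open>j \<le> i\<close>.\<close>
    have "c \<noteq> 0"
      using later[of i j] ij by (cases c) auto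
    then show ?thesis
      using True by (simp add: ennreal_mult_top)
  next
    case False
    then obtain L where L: "0 \<le> L" "grad_sup_norm G f = ennreal L"
      by (cases "grad_sup_norm G f") auto
    have lip: "\<bar>f x - f y\<bar> \<le> L" if "(x, y) \<in> parcs G" for x y
      using grad_sup_norm_le_iff[of G f "ennreal L"] L that by auto
    have "t i - real c * L \<le> t (i + c * vertex_profile G i)"
      using kth_largest_value_profile_steps[OF lip L(1) assms(3) t] ij by simp
    also have "\<dots> \<le> t j"
      using kth_largest_value_antimono[OF t t] later ij by simp
    finally have "\<bar>t i - t j\<bar> \<le> real c * L"
      using kth_largest_value_antimono[OF t t, of i j] ij by simp
    then show ?thesis
      using L by (simp add: ennreal_of_nat_eq_real_of_nat flip: ennreal_mult)
  qed
  have "ennreal \<bar>f_star x - f_star y\<bar> \<le> of_nat c * grad_sup_norm G f"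
    if xy: "(x, y) \<in> parcs G" for x y
  proof -
    \<comment> \<open>\<open>ordered\<close> expects the arc to run from the larger index to the
      smaller one, so both orientations are needed.\<close>
    have yx: "(y, x) \<in> parcs G"
      using xy pair_sym_arcs by (auto simp: symmetric_def dest: symD)
    have "x \<in> v ` {1..}" "y \<in> v ` {1..}" "x \<noteq> y"
      using arc_fst_in_verts[OF xy] arc_snd_in_verts[OF xy] pair_no_loops[OF xy]
        bij_betw_imp_surj_on[OF assms(4)] by simp_all
    then obtain i j where ij: "x = v i" "y = v j" "1 \<le> i" "1 \<le> j" "i \<noteq> j"
      by fastforce
    then show ?thesis
      using ordered[of i j] ordered[of j i] xy yx
      by (cases "i < j") (simp_all add: t_def abs_minus_commute)
  qed
  then show ?thesis
    by (auto simp: grad_sup_norm_le_iff)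
qed

end
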